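(* Let $w_m:=d^my$ for $m\in\mathbb{N}_0$. Then for every integer $n\ge2$ and all $k_1,\dots,k_n\in\mathbb{N}_0$, the following holds in $\mathcal{H}_0\otimes\mathcal{H}_0$: $$\tilde{\Delta}_0(w_{k_1}\cdots w_{k_n})=\sum_{i_1+j_1=k_1}\binom{k_1}{i_1}\,d^{i_1}y\otimes_{\mathrm{sym}}d^{j_1}w_{k_2}\cdots w_{k_n}$$ $$+\sum_{p=2}^{n-1}\ \sum_{\substack{i_1+j_1=k_1\\ \vdots\\ i_p+j_p=k_p}}\ \prod_{a=1}^p\binom{k_a}{i_a}\sum_{\substack{\{u_q,v_q\}=\{d^{i_q},\,d^{j_q}y\}\\ 1\le q\le p-1}}\bigl(u_1\cdots u_{p-1}d^{i_p}y\otimes_{\mathrm{sym}}v_1\cdots v_{p-1}d^{j_p}w_{k_{p+1}}\cdots w_{k_n}\bigr).$$ Here $i_a,j_a$ range over $\mathbb{N}_0$, and the innermost sum is over all choices, for each $1\le q\le p-1$, of $(u_q,v_q)=(d^{i_q},d^{j_q}y)$ or $(u_q,v_q)=(d^{j_q}y,d^{i_q})$.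
   Context: $\mathbb{N}_0=\{0,1,2,\dots\}$. Let $L=\{d,y\}$, let $L^*$ be the free monoid on $L$ with unit the empty word $\mathbf{1}$, and $\mathbb{Q}\langle L\rangle$ the $\mathbb{Q}$-span of $L^*$. Put $Y:=L^*y\cup\{\mathbf{1}\}$. Define a $\mathbb{Q}$-bilinear product $\sqcup\!\sqcup_0$ on $\mathbb{Q}\langle L\rangle$ recursively, for words $u,v,w\in L^*$, by $\mathbf 1\sqcup\!\sqcup_0 w=w\sqcup\!\sqcup_0\mathbf 1=w$; $\ yu\sqcup\!\sqcup_0 v=u\sqcup\!\sqcup_0 yv=y(u\sqcup\!\sqcup_0 v)$; $\ du\sqcup\!\sqcup_0 dv=d(u\sqcup\!\sqcup_0 dv)-u\sqcup\!\sqcup_0 d^2v$. Let $\mathcal{T}_-$ be the linear span of $\{wd\mid w\in L^*\}$; let $\mathcal{L}_-$ be the two-sided ideal of $(\mathbb{Q}\langle L\rangle,\sqcup\!\sqcup_0)$ generated by all $d^k\{d(u\sqcup\!\sqcup_0 v)-du\sqcup\!\sqcup_0 v-u\sqcup\!\sqcup_0 dv\}$ with $k\in\mathbb{N}_0$, $u,v\in L^*$; put $\mathcal{S}_-:=\mathcal{T}_-+\mathcal{L}_-$ (a two-sided ideal) and $\mathcal{H}_0:=\mathbb{Q}\langle L\rangle/\mathcal{S}_-$. Words are identified with their classes in $\mathcal{H}_0$. It is known (Ebrahimi-Fard–Manchon–Singer) that $\mathcal{H}_0$ is a connected filtered commutative and cocommutative Hopf algebra with product $\sqcup\!\sqcup_0$,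 unit $1=\mathbf 1$, and coproduct given, for $w=x_1\cdots x_N\in Y\setminus\{\mathbf 1\}$ ($x_i\in L$), by $\Delta_0(w)=\sum_{S}w_S\otimes w_{\overline S}$, the sum being over all $S\subset\{1,\dots,N\}$ (possibly empty) such that $w_S,w_{\overline S}\in Y$, where $\overline S$ is the complement of $S$ and $w_S:=x_{i_1}\cdots x_{i_r}$ for $S=\{i_1<\cdots<i_r\}$ (and $w_\emptyset=\mathbf 1$). The reduced coproduct $\tilde\Delta_0:\mathcal{H}_0\to\mathcal{H}_0\otimes\mathcal{H}_0$ is the linear map with $\tilde\Delta_0(w):=\Delta_0(w)-1\otimes w-w\otimes1$ for $w\in Y$. For $w,w'\in Y$, $w\otimes_{\mathrm{sym}}w':=w\otimes w'+w'\otimes w\in\mathcal{H}_0\otimes\mathcal{H}_0$. Juxtaposition of letters and words denotes concatenation. *)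

theory Defs
  imports Complex_Main "HOL-Library.Poly_Mapping" "HOL-Library.FuncSet"
begin

section \<open>Rational vector spaces\<close>

class rat_vector = ab_group_add +
  fixes scaleQ :: "rat \<Rightarrow> 'a \<Rightarrow> 'a"  (infixr "*\<^sub>Q" 75)
  assumes scaleQ_add_right: "a *\<^sub>Q (x + y) = a *\<^sub>Q x + a *\<^sub>Q y"
    and scaleQ_add_left: "(a + b) *\<^sub>Q x = a *\<^sub>Q x + b *\<^sub>Q x"
    and scaleQ_scaleQ: "a *\<^sub>Q b *\<^sub>Q x = (a * b) *\<^sub>Q x"
    and scaleQ_one: "1 *\<^sub>Q x = x"

global_interpretation rv: vector_space "scaleQ :: rat \<Rightarrow> 'a \<Rightarrow> 'a::rat_vector"
  by standard (simp_all add: scaleQ_add_right scaleQ_add_left scaleQ_scaleQ scaleQ_one)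

abbreviation rat_linear :: "('a::rat_vector \<Rightarrow> 'b::rat_vector) \<Rightarrow> bool"
  where "rat_linear \<equiv> Vector_Spaces.linear scaleQ scaleQ"

instantiation rat :: rat_vector
begin
definition scaleQ_rat :: "rat \<Rightarrow> rat \<Rightarrow> rat" where "scaleQ_rat = (*)"
instance by standard (simp_all add: scaleQ_rat_def algebra_simps)
end

instantiation poly_mapping :: (type, rat_vector) rat_vector
begin
definition scaleQ_poly_mapping :: "rat \<Rightarrow> ('a \<Rightarrow>\<^sub>0 'b) \<Rightarrow> 'a \<Rightarrow>\<^sub>0 'b"
  where "scaleQ_poly_mapping c = Poly_Mapping.map (scaleQ c)"

lemma lookup_scaleQ [simp]: "Poly_Mapping.lookup (c *\<^sub>Q p) x = c *\<^sub>Q Poly_Mapping.lookup p x"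
  for p :: "'a \<Rightarrow>\<^sub>0 'b"
  by (simp add: scaleQ_poly_mapping_def Poly_Mapping.map.rep_eq when_def rv.scale_zero_right)

instance
  by standard
    (rule poly_mapping_eqI, simp add: lookup_add scaleQ_add_right scaleQ_add_left
      scaleQ_scaleQ scaleQ_one)+
end

definition lin_ext :: "('a \<Rightarrow> 'b::rat_vector) \<Rightarrow> ('a \<Rightarrow>\<^sub>0 rat) \<Rightarrow> 'b"
  where "lin_ext f p = (\<Sum>x\<in>Poly_Mapping.keys p. Poly_Mapping.lookup p x *\<^sub>Q f x)"


section \<open>Tensor products of rational vector spaces\<close>

definition tensor_relators :: "('a::rat_vector \<times> 'b::rat_vector \<Rightarrow>\<^sub>0 rat) set"
  where "tensor_relators =
    {Poly_Mapping.single (a + a', b) 1 - Poly_Mapping.single (a, b) 1 - Poly_Mapping.single (a', b) 1 | a a' b. True} \<union>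
    {Poly_Mapping.single (a, b + b') 1 - Poly_Mapping.single (a, b) 1 - Poly_Mapping.single (a, b') 1 | a b b'. True} \<union>
    {Poly_Mapping.single (c *\<^sub>Q a, b) 1 - c *\<^sub>Q Poly_Mapping.single (a, b) 1 | c a b. True} \<union>
    {Poly_Mapping.single (a, c *\<^sub>Q b) 1 - c *\<^sub>Q Poly_Mapping.single (a, b) 1 | c a b. True}"

lemma equivp_subspace:
  assumes "rv.subspace S"
  shows "equivp (\<lambda>p q. p - q \<in> S)"
proof (rule equivpI)
  show "reflp (\<lambda>p q. p - q \<in> S)"
    using rv.subspace_0[OF assms] by (simp add: reflp_def)
  show "symp (\<lambda>p q. p - q \<in> S)"
  proof (rule sympI)
    fix x y assume "x - y \<in> S"
    from rv.subspace_neg[OF assms this] show "y - x \<in> S" by simp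
  qed
  show "transp (\<lambda>p q. p - q \<in> S)"
  proof (rule transpI)
    fix x y z assume "x - y \<in> S" "y - z \<in> S"
    from rv.subspace_add[OF assms this] show "x - z \<in> S" by simp
  qed
qed

lemma subspace_diff_add:
  assumes "rv.subspace S" "a - b \<in> S" "c - d \<in> S"
  shows "(a + c) - (b + d) \<in> S"
  using rv.subspace_add[OF assms] by (simp add: algebra_simps)

lemma subspace_diff_diff:
  assumes "rv.subspace S" "a - b \<in> S" "c - d \<in> S"
  shows "(a - c) - (b - d) \<in> S"
  using rv.subspace_diff[OF assms] by (simp add: algebra_simps)

lemma subspace_diff_neg:
  assumes "rv.subspace S" "a - b \<in> S"
  shows "- a - - b \<in> S"
  using rv.subspace_neg[OF assms] by (simp add: algebra_simps)

lemma subspace_diff_scale: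
  assumes "rv.subspace S" "a - b \<in> S"
  shows "c *\<^sub>Q a - c *\<^sub>Q b \<in> S"
  using rv.subspace_scale[OF assms, of c] by (simp add: rv.scale_right_diff_distrib)

quotient_type (overloaded) ('a, 'b) tensor =
  "'a::rat_vector \<times> 'b::rat_vector \<Rightarrow>\<^sub>0 rat" / "\<lambda>p q. p - q \<in> rv.span tensor_relators"
  by (rule equivp_subspace, rule rv.subspace_span)

instantiation tensor :: (rat_vector, rat_vector) rat_vector
begin

lift_definition zero_tensor :: "('a, 'b) tensor" is 0 .
lift_definition plus_tensor :: "('a, 'b) tensor \<Rightarrow> ('a, 'b) tensor \<Rightarrow> ('a, 'b) tensor"
  is "(+)" by (rule subspace_diff_add[OF rv.subspace_span])
lift_definition minus_tensor :: "('a, 'b) tensor \<Rightarrow> ('a, 'b) tensor \<Rightarrow> ('a, 'b) tensor"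
  is "(-)" by (rule subspace_diff_diff[OF rv.subspace_span])
lift_definition uminus_tensor :: "('a, 'b) tensor \<Rightarrow> ('a, 'b) tensor"
  is uminus by (rule subspace_diff_neg[OF rv.subspace_span])
lift_definition scaleQ_tensor :: "rat \<Rightarrow> ('a, 'b) tensor \<Rightarrow> ('a, 'b) tensor"
  is scaleQ by (rule subspace_diff_scale[OF rv.subspace_span])

instance
  by standard (transfer, simp add: algebra_simps rv.span_zero scaleQ_add_right
    scaleQ_add_left scaleQ_scaleQ scaleQ_one)+

end

lift_definition tensor_elem :: "'a::rat_vector \<Rightarrow> 'b::rat_vector \<Rightarrow> ('a, 'b) tensor"
  (infix "\<otimes>" 72) is "\<lambda>a b. Poly_Mapping.single (a, b) 1" .


section \<open>The algebra of words\<close>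

datatype letter = Ld | Ly

type_synonym word = "letter list"

type_synonym wordalg = "word \<Rightarrow>\<^sub>0 rat"

definition Ywords :: "word set"
  where "Ywords = {u @ [Ly] | u. True} \<union> {[]}"

definition prefix_letter :: "letter \<Rightarrow> wordalg \<Rightarrow> wordalg"
  where "prefix_letter x = lin_ext (\<lambda>u. Poly_Mapping.single (x # u) 1)"

text \<open>The defining equations overlap. The function below fixes an order of evaluation;
  the clauses that are lost in this way are recovered in the lemmas after it.\<close>

fun shuffle0_word :: "word \<Rightarrow> word \<Rightarrow> wordalg"
  where
    "shuffle0_word [] v = Poly_Mapping.single v 1"
  | "shuffle0_word (Ly # u) v = prefix_letter Ly (shuffle0_word u v)"
  | "shuffle0_word (Ld # u) [] = Poly_Mapping.single (Ld # u) 1"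
  | "shuffle0_word (Ld # u) (Ly # v) = prefix_letter Ly (shuffle0_word (Ld # u) v)"
  | "shuffle0_word (Ld # u) (Ld # v) =
       prefix_letter Ld (shuffle0_word u (Ld # v)) - shuffle0_word u (Ld # Ld # v)"

lemma prefix_letter_single: "prefix_letter x (Poly_Mapping.single u 1) = Poly_Mapping.single (x # u) 1"
  by (simp add: prefix_letter_def lin_ext_def scaleQ_one)

lemma shuffle0_word_Nil_right: "shuffle0_word u [] = Poly_Mapping.single u 1"
proof (induction u)
  case (Cons x u)
  then show ?case by (cases x) (simp_all add: prefix_letter_single)
qed simp

lemma shuffle0_word_y_right:
  "shuffle0_word u (Ly # v) = prefix_letter Ly (shuffle0_word u v)"
proof (induction u)
  case (Cons x u)
  then show ?case by (cases x) simp_all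
qed (simp add: prefix_letter_single)

definition shuffle0 :: "wordalg \<Rightarrow> wordalg \<Rightarrow> wordalg"
  where "shuffle0 p q = lin_ext (\<lambda>u. lin_ext (\<lambda>v. shuffle0_word u v) q) p"


section \<open>The quotient\<close>

definition Tminus :: "wordalg set"
  where "Tminus = rv.span {Poly_Mapping.single (u @ [Ld]) 1 | u. True}"

definition two_sided_ideal :: "wordalg set \<Rightarrow> bool"
  where "two_sided_ideal I \<longleftrightarrow>
    rv.subspace I \<and> (\<forall>p. \<forall>x\<in>I. shuffle0 p x \<in> I \<and> shuffle0 x p \<in> I)"

definition Lminus_generators :: "wordalg set"
  where "Lminus_generators =
    {(prefix_letter Ld ^^ k)
       (prefix_letter Ld (shuffle0_word u v) - shuffle0_word (Ld # u) v
          - shuffle0_word u (Ld # v)) | k u v. True}"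

definition Lminus :: "wordalg set"
  where "Lminus = two_sided_ideal hull Lminus_generators"

definition Sminus :: "wordalg set"
  where "Sminus = {a + b | a b. a \<in> Tminus \<and> b \<in> Lminus}"

lemma subspace_Sminus: "rv.subspace Sminus"
proof -
  have "rv.subspace Lminus"
    unfolding Lminus_def hull_def by (rule rv.subspace_Inter) (auto simp: two_sided_ideal_def)
  then show ?thesis
    unfolding Sminus_def Tminus_def by (rule rv.subspace_sums[OF rv.subspace_span])
qed

quotient_type H0 = wordalg / "\<lambda>p q. p - q \<in> Sminus"
  by (rule equivp_subspace, rule subspace_Sminus)

instantiation H0 :: rat_vector
begin

lift_definition zero_H0 :: H0 is 0 .
lift_definition plus_H0 :: "H0 \<Rightarrow> H0 \<Rightarrow> H0"
  is "(+)" by (rule subspace_diff_add[OF subspace_Sminus])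
lift_definition minus_H0 :: "H0 \<Rightarrow> H0 \<Rightarrow> H0"
  is "(-)" by (rule subspace_diff_diff[OF subspace_Sminus])
lift_definition uminus_H0 :: "H0 \<Rightarrow> H0"
  is uminus by (rule subspace_diff_neg[OF subspace_Sminus])
lift_definition scaleQ_H0 :: "rat \<Rightarrow> H0 \<Rightarrow> H0"
  is scaleQ by (rule subspace_diff_scale[OF subspace_Sminus])

instance
  by standard (transfer, simp add: algebra_simps rv.subspace_0[OF subspace_Sminus]
    scaleQ_add_right scaleQ_add_left scaleQ_scaleQ scaleQ_one)+

end

lift_definition cls :: "word \<Rightarrow> H0" is "\<lambda>u. Poly_Mapping.single u 1" .


section \<open>Coproduct and reduced coproduct\<close>

text \<open>The words in \<^const>\<open>Ywords\<close> span the quotient, so there is at most one linear map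
  with prescribed values on them; existence for the two maps below is part of the Hopf algebra
  structure.\<close>

definition linear_from_Ywords :: "(word \<Rightarrow> 'a::rat_vector) \<Rightarrow> H0 \<Rightarrow> 'a"
  where "linear_from_Ywords g = (THE f. rat_linear f \<and> (\<forall>w\<in>Ywords. f (cls w) = g w))"

text \<open>Positions are counted from 0. For the empty word the sum consists of the single term
  \<open>cls [] \<otimes> cls []\<close>, which is the value of the coproduct at the unit.\<close>

definition coproduct0 :: "H0 \<Rightarrow> (H0, H0) tensor"
  where "coproduct0 = linear_from_Ywords (\<lambda>w.
    \<Sum>S | S \<subseteq> {..<length w} \<and> nths w S \<in> Ywords \<and> nths w ({..<length w} - S) \<in> Ywords.
      cls (nths w S) \<otimes> cls (nths w ({..<length w} - S)))"

definition reduced_coproduct0 :: "H0 \<Rightarrow> (H0, H0) tensor"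
  where "reduced_coproduct0 = linear_from_Ywords (\<lambda>w.
    coproduct0 (cls w) - cls [] \<otimes> cls w - cls w \<otimes> cls [])"

definition tensor_sym :: "word \<Rightarrow> word \<Rightarrow> (H0, H0) tensor"  (infix "\<otimes>\<^sub>s\<^sub>y\<^sub>m" 72)
  where "u \<otimes>\<^sub>s\<^sub>y\<^sub>m v = cls u \<otimes> cls v + cls v \<otimes> cls u"

abbreviation dpow :: "nat \<Rightarrow> word"
  where "dpow m \<equiv> replicate m Ld"

definition dy :: "nat \<Rightarrow> word"
  where "dy m = dpow m @ [Ly]"

text \<open>\<open>dys k a b\<close> is the word \<open>dy (k a) \<dots> dy (k b)\<close>.\<close>

definition dys :: "(nat \<Rightarrow> nat) \<Rightarrow> nat \<Rightarrow> nat \<Rightarrow> word"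
  where "dys k a b = concat (map (\<lambda>q. dy (k q)) [a..<Suc b])"

text \<open>The tuples \<open>(i\<^sub>1, \<dots>, i\<^sub>p)\<close>, \<open>(j\<^sub>1, \<dots>, j\<^sub>p)\<close> with \<open>i\<^sub>a + j\<^sub>a = k\<^sub>a\<close>.\<close>

definition splittings :: "(nat \<Rightarrow> nat) \<Rightarrow> nat \<Rightarrow> ((nat \<Rightarrow> nat) \<times> (nat \<Rightarrow> nat)) set"
  where "splittings k p =
    {(i, j). i \<in> {1..p} \<rightarrow>\<^sub>E UNIV \<and> j \<in> {1..p} \<rightarrow>\<^sub>E UNIV \<and> (\<forall>a\<in>{1..p}. i a + j a = k a)}"

definition uv_choices ::
    "(nat \<Rightarrow> nat) \<Rightarrow> (nat \<Rightarrow> nat) \<Rightarrow> nat \<Rightarrow> ((nat \<Rightarrow> word) \<times> (nat \<Rightarrow> word)) set"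
  where "uv_choices i j m =
    {(u, v). u \<in> {1..m} \<rightarrow>\<^sub>E UNIV \<and> v \<in> {1..m} \<rightarrow>\<^sub>E UNIV \<and>
      (\<forall>q\<in>{1..m}. (u q, v q) = (dpow (i q), dy (j q)) \<or> (u q, v q) = (dy (j q), dpow (i q)))}"

end

theory Submission imports Defs begin

text \<open>
  The coproduct is defined by its values on a spanning set of words, so its well-definedness on
  \<open>\<H>\<^sub>0\<close> has to be shown. Let \<open>X\<close>, \<open>Y\<close> be linear operators such that \<open>Y\<close> commutes
  with all iterated commutators \<open>[X, \<dots>, [X, Y]]\<close>. Sending \<open>\<one>\<close> to the identity, \<open>yu\<close> to
  \<open>Y M(u)\<close> and \<open>du\<close> to \<open>[X, M(u)]\<close> defines operators \<open>M(u)\<close> that turn the product of words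
  into composition, and \<open>M\<close> vanishes on \<open>\<S>\<^sub>-\<close>. Prepending \<open>d\<close> and \<open>y\<close> gives such a pair on
  \<open>\<H>\<^sub>0\<close>, where the iterated commutators are the left multiplications by \<open>d\<^sup>n y\<close>. Hence
  the operators \<open>d \<otimes> 1 + 1 \<otimes> d\<close> and \<open>y \<otimes> 1 + 1 \<otimes> y\<close> form such a pair as well. Applying the
  resulting operators \<open>M(w)\<close> to \<open>\<one> \<otimes> \<one>\<close> gives the coproduct of \<open>w\<close>.

  For the formula, suppose that the last \<open>y\<close> of \<open>w\<^bsub>k\<^sub>1\<^esub> \<dots> w\<^bsub>k\<^sub>n\<^esub>\<close> goes to the right factor and that
  the last \<open>y\<close> going to the left factor lies in the \<open>p\<close>-th block. A left factor ending in \<open>d\<close>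
  vanishes, so all later letters go to the right. The other half of the sum is symmetric.
\<close>

section \<open>Linear maps and linear extension from a basis\<close>

section \<open>Linear maps\<close>

lemma rat_linear_iff:
  "rat_linear f \<longleftrightarrow> (\<forall>x y. f (x + y) = f x + f y) \<and> (\<forall>c x. f (c *\<^sub>Q x) = c *\<^sub>Q f x)"
  by (simp add: Vector_Spaces.linear_def module_hom_def module_hom_axioms_def
      rv.vector_space_axioms rv.module_axioms)

lemma
  assumes "rat_linear f"
  shows rat_linear_add: "f (x + y) = f x + f y"
    and rat_linear_scale: "f (c *\<^sub>Q x) = c *\<^sub>Q f x"
  using assms by (auto simp: rat_linear_iff)

lemma rat_linear_zero: "rat_linear f \<Longrightarrow> f 0 = 0"
  using rat_linear_add[of f 0 0] by simp

lemma rat_linear_minus: "rat_linear f \<Longrightarrow> f (x - y) = f x - f y"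
  using rat_linear_add[of f "x - y" y] by (simp add: algebra_simps)

lemma rat_linear_sum: "rat_linear f \<Longrightarrow> f (sum g A) = (\<Sum>x\<in>A. f (g x))"
  by (induction A rule: infinite_finite_induct) (simp_all add: rat_linear_zero rat_linear_add)

lemma rat_linear_id: "rat_linear (\<lambda>x. x)"
  by (simp add: rat_linear_iff)

lemma rat_linear_compose: "rat_linear f \<Longrightarrow> rat_linear g \<Longrightarrow> rat_linear (\<lambda>x. f (g x))"
  by (simp add: rat_linear_iff)

lemma rat_linear_plus_fun: "rat_linear f \<Longrightarrow> rat_linear g \<Longrightarrow> rat_linear (\<lambda>x. f x + g x)"
  by (simp add: rat_linear_iff rv.scale_right_distrib)

lemma rat_linear_minus_fun: "rat_linear f \<Longrightarrow> rat_linear g \<Longrightarrow> rat_linear (\<lambda>x. f x - g x)"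
  by (simp add: rat_linear_iff rv.scale_right_diff_distrib)

lemma subspace_rat_linear_kernel: "rat_linear f \<Longrightarrow> rv.subspace {x. f x = 0}"
  by (auto simp: rv.subspace_def rat_linear_zero rat_linear_add rat_linear_scale
      rv.scale_zero_right)

lemma rat_linear_vanishes_span:
  assumes "rat_linear f" "\<And>x. x \<in> S \<Longrightarrow> f x = 0" "x \<in> rv.span S"
  shows "f x = 0"
  using rv.span_minimal[OF _ subspace_rat_linear_kernel[OF assms(1)], of S] assms(2,3) by blast

lemma lin_ext_superset:
  assumes "finite A" "Poly_Mapping.keys p \<subseteq> A"
  shows "lin_ext f p = (\<Sum>x\<in>A. Poly_Mapping.lookup p x *\<^sub>Q f x)"
  unfolding lin_ext_def
  by (rule sum.mono_neutral_left) (use assms in \<open>auto simp: in_keys_iff rv.scale_zero_left\<close>)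

lemma rat_linear_lin_ext: "rat_linear (lin_ext f)"
  unfolding rat_linear_iff
proof safe
  fix p q :: "'a \<Rightarrow>\<^sub>0 rat" and c :: rat
  let ?A = "Poly_Mapping.keys p \<union> Poly_Mapping.keys q \<union> Poly_Mapping.keys (p + q)"
  show "lin_ext f (p + q) = lin_ext f p + lin_ext f q"
    by (simp add: lin_ext_superset[of ?A p] lin_ext_superset[of ?A q] lin_ext_superset[of ?A "p + q"]
        le_supI1 lookup_add scaleQ_add_left sum.distrib)
  let ?B = "Poly_Mapping.keys p \<union> Poly_Mapping.keys (c *\<^sub>Q p)"
  show "lin_ext f (c *\<^sub>Q p) = c *\<^sub>Q lin_ext f p"
    by (simp add: lin_ext_superset[of ?B p] lin_ext_superset[of ?B "c *\<^sub>Q p"] scaleQ_rat_def scaleQ_scaleQ rv.scale_sum_right)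
qed

lemma lin_ext_single [simp]: "lin_ext f (Poly_Mapping.single x 1) = f x"
  by (simp add: lin_ext_def scaleQ_one)

lemma rat_linear_lin_ext_fun:
  assumes "rat_linear h"
  shows "h (lin_ext f p) = lin_ext (\<lambda>x. h (f x)) p"
  by (simp add: lin_ext_def rat_linear_sum[OF assms] rat_linear_scale[OF assms])

lemma rat_linear_lin_ext_param:
  assumes "\<And>x. rat_linear (f x)"
  shows "rat_linear (\<lambda>t. lin_ext (\<lambda>x. f x t) p)"
  using assms by (simp add: rat_linear_iff lin_ext_def scaleQ_add_right sum.distrib
      rv.scale_sum_right mult.commute)

lemma lin_ext_diff_fun: "lin_ext (\<lambda>x. f x - g x) p = lin_ext f p - lin_ext g p"
  by (simp add: lin_ext_def rv.scale_right_diff_distrib sum_subtractf)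

lemma lin_ext_lin_ext: "lin_ext g (lin_ext f p) = lin_ext (\<lambda>x. lin_ext g (f x)) p"
  by (rule rat_linear_lin_ext_fun[OF rat_linear_lin_ext])

lemma lin_ext_in_subspace:
  assumes "rv.subspace S" "\<And>x. f x \<in> S"
  shows "lin_ext f p \<in> S"
  unfolding lin_ext_def by (intro rv.subspace_sum rv.subspace_scale assms)

lemma poly_mapping_lin_ext_single: "lin_ext (\<lambda>x. Poly_Mapping.single x 1) p = p"
proof (rule poly_mapping_eqI)
  fix y
  have "Poly_Mapping.lookup (lin_ext (\<lambda>x. Poly_Mapping.single x (1::rat)) p) y =
    (\<Sum>x\<in>Poly_Mapping.keys p. if x = y then Poly_Mapping.lookup p x else 0)"
    unfolding lin_ext_def lookup_sum
    by (rule sum.cong) (auto simp: lookup_single scaleQ_rat_def)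
  then show "Poly_Mapping.lookup (lin_ext (\<lambda>x. Poly_Mapping.single x (1::rat)) p) y =
    Poly_Mapping.lookup p y"
    by (simp add: in_keys_iff)
qed

lemma rat_linear_eq_lin_ext:
  assumes "rat_linear f"
  shows "f p = lin_ext (\<lambda>x. f (Poly_Mapping.single x 1)) p"
  using rat_linear_lin_ext_fun[OF assms, of "\<lambda>x. Poly_Mapping.single x 1" p]
  by (simp add: poly_mapping_lin_ext_single)

lemma rat_linear_eqI_single:
  fixes f :: "('a \<Rightarrow>\<^sub>0 rat) \<Rightarrow> 'b::rat_vector"
  assumes "rat_linear f" "rat_linear g"
    "\<And>x. f (Poly_Mapping.single x 1) = g (Poly_Mapping.single x 1)"
  shows "f p = g p"
  using assms(3) by (simp add: rat_linear_eq_lin_ext[OF assms(1), of p]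
      rat_linear_eq_lin_ext[OF assms(2), of p])


section \<open>The universal property of the tensor product\<close>

section \<open>Tensor products\<close>

lemma tensor_add_left: "(a + a') \<otimes> b = a \<otimes> b + a' \<otimes> b"
  by transfer (rule rv.span_base, force simp: tensor_relators_def algebra_simps)

lemma tensor_add_right: "a \<otimes> (b + b') = a \<otimes> b + a \<otimes> b'"
  by transfer (rule rv.span_base, force simp: tensor_relators_def algebra_simps)

lemma tensor_scale_left: "(c *\<^sub>Q a) \<otimes> b = c *\<^sub>Q (a \<otimes> b)"
  by transfer (rule rv.span_base, force simp: tensor_relators_def)

lemma tensor_scale_right: "a \<otimes> (c *\<^sub>Q b) = c *\<^sub>Q (a \<otimes> b)"
  by transfer (rule rv.span_base, force simp: tensor_relators_def)

lemma rat_linear_tensor_left: "rat_linear (\<lambda>a. a \<otimes> b)"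
  and rat_linear_tensor_right: "rat_linear (\<lambda>b. a \<otimes> b)"
  by (simp_all add: rat_linear_iff tensor_add_left tensor_add_right tensor_scale_left
      tensor_scale_right)

lemma rat_linear_abs_tensor: "rat_linear abs_tensor"
  by (simp add: rat_linear_iff plus_tensor.abs_eq scaleQ_tensor.abs_eq)

lemma abs_rep_tensor: "abs_tensor (rep_tensor t) = t"
  by (rule Quotient3_abs_rep[OF Quotient3_tensor])

lemma tensor_eqI:
  assumes "rat_linear f" "rat_linear g" "\<And>a b. f (a \<otimes> b) = g (a \<otimes> b)"
  shows "f t = g t"
proof -
  have "f (abs_tensor p) = g (abs_tensor p)" for p
  proof (rule rat_linear_eqI_single[where f = "\<lambda>p. f (abs_tensor p)" and g = "\<lambda>p. g (abs_tensor p)"])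
    show "f (abs_tensor (Poly_Mapping.single x 1)) = g (abs_tensor (Poly_Mapping.single x 1))" for x
      using assms(3)[of "fst x" "snd x"] by (simp add: tensor_elem.abs_eq)
  qed (rule rat_linear_compose[OF assms(1) rat_linear_abs_tensor]
      rat_linear_compose[OF assms(2) rat_linear_abs_tensor])+
  from this[of "rep_tensor t"] show ?thesis by (simp add: abs_rep_tensor)
qed

definition tensor_lift :: "('a::rat_vector \<Rightarrow> 'b::rat_vector \<Rightarrow> 'c::rat_vector) \<Rightarrow> ('a, 'b) tensor \<Rightarrow> 'c"
  where "tensor_lift B t = lin_ext (\<lambda>(a, b). B a b) (rep_tensor t)"

context
  fixes B :: "'a::rat_vector \<Rightarrow> 'b::rat_vector \<Rightarrow> 'c::rat_vector"
  assumes lin1: "\<And>b. rat_linear (\<lambda>a. B a b)" and lin2: "\<And>a. rat_linear (B a)"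
begin

text \<open>Bilinearity of \<open>B\<close> says that its linear extension kills the relators, hence
  their span, and two representatives of one tensor differ by an element of that span.\<close>

lemma tensor_lift_abs: "tensor_lift B (abs_tensor p) = lin_ext (\<lambda>(a, b). B a b) p"
proof -
  have "lin_ext (\<lambda>(a, b). B a b) r = 0" if "r \<in> tensor_relators" for r
    using that unfolding tensor_relators_def
    by (auto simp: rat_linear_minus[OF rat_linear_lin_ext] rat_linear_scale[OF rat_linear_lin_ext]
        rat_linear_add[OF lin1] rat_linear_add[OF lin2]
        rat_linear_scale[OF lin1] rat_linear_scale[OF lin2])
  moreover have "rep_tensor (abs_tensor p) - p \<in> rv.span tensor_relators"
    by (simp add: abs_rep_tensor flip: tensor.abs_eq_iff)
  ultimately have "lin_ext (\<lambda>(a, b). B a b) (rep_tensor (abs_tensor p) - p) = 0"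
    by (rule rat_linear_vanishes_span[OF rat_linear_lin_ext])
  then show ?thesis
    by (simp add: tensor_lift_def rat_linear_minus[OF rat_linear_lin_ext])
qed

lemma tensor_lift_elem: "tensor_lift B (a \<otimes> b) = B a b"
  by (simp add: tensor_elem.abs_eq tensor_lift_abs)

lemma rat_linear_tensor_lift: "rat_linear (tensor_lift B)"
  unfolding rat_linear_iff
proof safe
  fix s t :: "('a, 'b) tensor" and c :: rat
  have "tensor_lift B (abs_tensor p + abs_tensor q) =
      tensor_lift B (abs_tensor p) + tensor_lift B (abs_tensor q)" for p q
    by (simp add: tensor_lift_abs rat_linear_add[OF rat_linear_lin_ext]
        flip: rat_linear_add[OF rat_linear_abs_tensor])
  from this[of "rep_tensor s" "rep_tensor t"]
  show "tensor_lift B (s + t) = tensor_lift B s + tensor_lift B t"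
    by (simp add: abs_rep_tensor)
  have "tensor_lift B (c *\<^sub>Q abs_tensor p) = c *\<^sub>Q tensor_lift B (abs_tensor p)" for p
    by (simp add: tensor_lift_abs rat_linear_scale[OF rat_linear_lin_ext]
        flip: rat_linear_scale[OF rat_linear_abs_tensor])
  from this[of "rep_tensor s"]
  show "tensor_lift B (c *\<^sub>Q s) = c *\<^sub>Q tensor_lift B s"
    by (simp add: abs_rep_tensor)
qed

end

text \<open>The operator f \<otimes> 1 + 1 \<otimes> f: the action of a Lie algebra element on a
  tensor square.\<close>

definition diag_op :: "('a::rat_vector \<Rightarrow> 'a) \<Rightarrow> ('a, 'a) tensor \<Rightarrow> ('a, 'a) tensor"
  where "diag_op f = tensor_lift (\<lambda>a b. f a \<otimes> b + a \<otimes> f b)"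

context
  fixes f :: "'a::rat_vector \<Rightarrow> 'a"
  assumes lin: "rat_linear f"
begin

private lemma bilinear:
  "rat_linear (\<lambda>a. f a \<otimes> b + a \<otimes> f b)" "rat_linear (\<lambda>b. f a \<otimes> b + a \<otimes> f b)"
  using lin by (auto intro!: rat_linear_plus_fun rat_linear_tensor_left rat_linear_tensor_right
      rat_linear_compose[OF rat_linear_tensor_left lin]
      rat_linear_compose[OF rat_linear_tensor_right lin])

lemma diag_op_elem: "diag_op f (a \<otimes> b) = f a \<otimes> b + a \<otimes> f b"
  unfolding diag_op_def by (rule tensor_lift_elem[OF bilinear])

lemma rat_linear_diag_op: "rat_linear (diag_op f)"
  unfolding diag_op_def by (rule rat_linear_tensor_lift[OF bilinear])

end


section \<open>Operators attached to words, vanishing on \<open>Sminus\<close>\<close>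

section \<open>Words acting by nested commutators\<close>

primrec iter_ad :: "('a \<Rightarrow> 'a::rat_vector) \<Rightarrow> ('a \<Rightarrow> 'a) \<Rightarrow> nat \<Rightarrow> 'a \<Rightarrow> 'a"
  where
    "iter_ad X Y 0 = Y"
  | "iter_ad X Y (Suc n) = (\<lambda>t. X (iter_ad X Y n t) - iter_ad X Y n (X t))"

lemma rat_linear_iter_ad:
  assumes "rat_linear X" "rat_linear Y"
  shows "rat_linear (iter_ad X Y n)"
proof (induction n)
  case (Suc n)
  show ?case
    using rat_linear_minus_fun[OF rat_linear_compose[OF assms(1) Suc] rat_linear_compose[OF Suc assms(1)]]
    by simp
qed (simp add: assms(2))

locale derivation_pair =
  fixes X Y :: "'a::rat_vector \<Rightarrow> 'a"
  assumes linear_X: "rat_linear X" and linear_Y: "rat_linear Y"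
    and Y_iter_ad: "Y (iter_ad X Y n t) = iter_ad X Y n (Y t)"
begin

abbreviation ad :: "nat \<Rightarrow> 'a \<Rightarrow> 'a" where "ad \<equiv> iter_ad X Y"

lemma linear_ad: "rat_linear (ad n)"
  by (rule rat_linear_iter_ad[OF linear_X linear_Y])

lemma X_ad: "X (ad n t) = ad (Suc n) t + ad n (X t)"
  by simp

text \<open>The letter d acts by the commutator with \<open>X\<close>, not by \<open>X\<close>
  itself: ad(X) is a derivation of composition and kills the identity, as the relations in
  \<open>Sminus\<close> demand.\<close>

primrec act :: "word \<Rightarrow> 'a \<Rightarrow> 'a"
  where
    "act [] = (\<lambda>t. t)"
  | "act (x # u) = (case x of Ly \<Rightarrow> (\<lambda>t. Y (act u t)) | Ld \<Rightarrow> (\<lambda>t. X (act u t) - act u (X t)))"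

definition act_lin :: "wordalg \<Rightarrow> 'a \<Rightarrow> 'a"
  where "act_lin p t = lin_ext (\<lambda>u. act u t) p"

lemma linear_act: "rat_linear (act u)"
proof (induction u)
  case (Cons x u)
  show ?case
    using rat_linear_minus_fun[OF rat_linear_compose[OF linear_X Cons] rat_linear_compose[OF Cons linear_X]]
      rat_linear_compose[OF linear_Y Cons]
    by (cases x) simp_all
qed (simp add: rat_linear_id)

text \<open>Moving \<open>X\<close> past \<open>ad n\<close> costs a term with
  \<open>ad (Suc n)\<close>, so all \<open>n\<close> are treated at once. In the commutator for d
  this term arises twice, with opposite signs.\<close>

lemma act_ad: "act u (ad n t) = ad n (act u t)"
proof (induction u arbitrary: n t)
  case (Cons x u)
  show ?case
  proof (cases x)
    case Ld
    have "act u (X (ad n t)) = ad (Suc n) (act u t) + ad n (act u (X t))"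
      by (simp only: X_ad rat_linear_add[OF linear_act] Cons.IH)
    then show ?thesis
      by (simp add: Ld Cons.IH rat_linear_minus[OF linear_ad])
  qed (simp add: Cons.IH Y_iter_ad)
qed simp

lemma act_Y: "act u (Y t) = Y (act u t)"
  using act_ad[of u 0] by simp

lemma act_lin_single [simp]: "act_lin (Poly_Mapping.single u 1) t = act u t"
  by (simp add: act_lin_def)

lemma act_lin_minus: "act_lin (p - q) t = act_lin p t - act_lin q t"
  by (simp add: act_lin_def rat_linear_minus[OF rat_linear_lin_ext])

lemma linear_act_lin: "rat_linear (act_lin p)"
  unfolding act_lin_def using linear_act by (rule rat_linear_lin_ext_param)

lemma act_lin_prefix_letter:
  "act_lin (prefix_letter Ly p) t = Y (act_lin p t)"
  "act_lin (prefix_letter Ld p) t = X (act_lin p t) - act_lin p (X t)"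
  by (simp_all add: act_lin_def prefix_letter_def lin_ext_lin_ext lin_ext_diff_fun
      rat_linear_lin_ext_fun[OF linear_X] rat_linear_lin_ext_fun[OF linear_Y])

text \<open>Composition obeys the recursion of the product: for A = \<open>act u\<close> and B =
  \<open>act (Ld # v)\<close>, the clause for two d's reads [X, A] B = [X, A B] - A [X, B].\<close>

lemma act_lin_shuffle0_word: "act_lin (shuffle0_word u v) t = act u (act v t)"
proof (induction u v arbitrary: t rule: shuffle0_word.induct)
  \<comment> \<open>Here y stands on the right, so \<open>Y\<close> has to be pulled out past
    \<open>act (Ld # u)\<close>.\<close>
  case (4 u v)
  then show ?case
    using act_Y[of "Ld # u" "act v t"] by (simp add: act_lin_prefix_letter)
qed (simp_all add: act_lin_prefix_letter act_lin_minus rat_linear_minus[OF linear_act])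

lemma act_lin_shuffle0: "act_lin (shuffle0 p q) t = act_lin p (act_lin q t)"
proof -
  have "act_lin (shuffle0 p q) t = lin_ext (\<lambda>u. lin_ext (\<lambda>v. act_lin (shuffle0_word u v) t) q) p"
    by (simp add: shuffle0_def act_lin_def lin_ext_lin_ext)
  also have "\<dots> = lin_ext (\<lambda>u. act u (lin_ext (\<lambda>v. act v t) q)) p"
    by (simp add: act_lin_shuffle0_word rat_linear_lin_ext_fun[OF linear_act])
  finally show ?thesis
    by (simp add: act_lin_def)
qed

lemma act_snoc_Ld: "act (u @ [Ld]) t = 0"
proof (induction u arbitrary: t)
  case (Cons x u)
  then show ?case
    by (cases x) (simp_all add: rat_linear_zero[OF linear_X] rat_linear_zero[OF linear_Y])
qed simp

text \<open>The elements acting as 0 form a two-sided ideal, as the product acts by composition. It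
  contains the generators since ad(X) is a derivation; further d's only take commutators of
  0.\<close>

lemma act_lin_Lminus:
  assumes "p \<in> Lminus"
  shows "act_lin p t = 0"
proof -
  let ?K = "{p. \<forall>t. act_lin p t = 0}"
  have "rv.subspace ?K"
    by (auto simp: rv.subspace_def act_lin_def rat_linear_zero[OF rat_linear_lin_ext]
        rat_linear_add[OF rat_linear_lin_ext] rat_linear_scale[OF rat_linear_lin_ext]
        rv.scale_zero_right)
  then have "two_sided_ideal ?K"
    by (auto simp: two_sided_ideal_def act_lin_shuffle0 rat_linear_zero[OF linear_act_lin])
  moreover have "(prefix_letter Ld ^^ k) (prefix_letter Ld (shuffle0_word u v)
      - shuffle0_word (Ld # u) v - shuffle0_word u (Ld # v)) \<in> ?K" for k u v
    by (induction k)
      (simp_all add: act_lin_minus act_lin_prefix_letter act_lin_shuffle0_word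
        rat_linear_minus[OF linear_act] rat_linear_zero[OF linear_X])
  then have "Lminus_generators \<subseteq> ?K"
    by (auto simp: Lminus_generators_def)
  ultimately have "Lminus \<subseteq> ?K"
    unfolding Lminus_def by (intro hull_minimal)
  with assms show ?thesis by blast
qed

lemma act_lin_Sminus:
  assumes "p \<in> Sminus"
  shows "act_lin p t = 0"
proof -
  obtain a b where p: "p = a + b" and a: "a \<in> Tminus" and b: "b \<in> Lminus"
    using assms by (auto simp: Sminus_def)
  have "act_lin a t = 0"
    unfolding act_lin_def
    by (rule rat_linear_vanishes_span[OF rat_linear_lin_ext _ a[unfolded Tminus_def]])
      (auto simp: act_snoc_Ld)
  with act_lin_Lminus[OF b] show ?thesis
    by (simp add: p act_lin_def rat_linear_add[OF rat_linear_lin_ext])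
qed

end

text \<open>\<open>diag_op\<close> respects commutators because the mixed terms cancel. Hence it
  carries iterated commutators to iterated commutators and commuting operators to commuting
  ones.\<close>

lemma derivation_pair_diag_op:
  assumes "derivation_pair X Y"
  shows "derivation_pair (diag_op X) (diag_op Y)"
proof -
  interpret derivation_pair X Y by fact
  note lin = linear_X linear_Y linear_ad
  have iter: "iter_ad (diag_op X) (diag_op Y) n = diag_op (ad n)" for n
  proof (induction n)
    case (Suc n)
    show ?case
    proof
      fix t
      show "iter_ad (diag_op X) (diag_op Y) (Suc n) t = diag_op (ad (Suc n)) t"
      proof (rule tensor_eqI[where f = "iter_ad (diag_op X) (diag_op Y) (Suc n)"])
        show "rat_linear (iter_ad (diag_op X) (diag_op Y) (Suc n))"
          by (intro rat_linear_iter_ad rat_linear_diag_op lin)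
        show "rat_linear (diag_op (ad (Suc n)))"
          by (intro rat_linear_diag_op lin)
        show "iter_ad (diag_op X) (diag_op Y) (Suc n) (a \<otimes> b) = diag_op (ad (Suc n)) (a \<otimes> b)" for a b
          by (subst diag_op_elem[OF lin(3)])
            (simp add: Suc.IH diag_op_elem lin rat_linear_add[OF rat_linear_diag_op[OF lin(1)]]
              rat_linear_add[OF rat_linear_diag_op[OF lin(3)]]
              rat_linear_minus[OF rat_linear_tensor_left] rat_linear_minus[OF rat_linear_tensor_right])
      qed
    qed
  qed simp
  show ?thesis
  proof (rule derivation_pair.intro)
    show "rat_linear (diag_op X)" "rat_linear (diag_op Y)"
      by (intro rat_linear_diag_op lin)+
    fix n t
    show "diag_op Y (iter_ad (diag_op X) (diag_op Y) n t) = iter_ad (diag_op X) (diag_op Y) n (diag_op Y t)"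
      unfolding iter
    proof (rule tensor_eqI[where f = "\<lambda>t. diag_op Y (diag_op (ad n) t)"])
      show "rat_linear (\<lambda>t. diag_op Y (diag_op (ad n) t))" "rat_linear (\<lambda>t. diag_op (ad n) (diag_op Y t))"
        by (intro rat_linear_compose[OF rat_linear_diag_op rat_linear_diag_op] lin)+
      show "diag_op Y (diag_op (ad n) (a \<otimes> b)) = diag_op (ad n) (diag_op Y (a \<otimes> b))" for a b
        by (simp add: diag_op_elem lin rat_linear_add[OF rat_linear_diag_op[OF lin(2)]]
            rat_linear_add[OF rat_linear_diag_op[OF lin(3)]] Y_iter_ad)
    qed
  qed
qed


section \<open>Prepending a letter as an operator on \<open>H0\<close>\<close>

section \<open>The quotient\<close>

lemma rat_linear_prefix_letter: "rat_linear (prefix_letter x)"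
  unfolding prefix_letter_def by (rule rat_linear_lin_ext)

lemma two_sided_ideal_Lminus: "two_sided_ideal Lminus"
  unfolding Lminus_def
  by (rule hull_in) (auto simp: two_sided_ideal_def intro!: rv.subspace_Inter)

lemma Lminus_subspace: "rv.subspace Lminus"
  using two_sided_ideal_Lminus by (simp add: two_sided_ideal_def)

lemma Lminus_generator:
  "(prefix_letter Ld ^^ k) (prefix_letter Ld (shuffle0_word u v)
    - shuffle0_word (Ld # u) v - shuffle0_word u (Ld # v)) \<in> Lminus"
  unfolding Lminus_def by (rule hull_inc) (auto simp: Lminus_generators_def)

lemma shuffle0_Leibniz:
  "prefix_letter Ld (shuffle0 p q) - shuffle0 (prefix_letter Ld p) q - shuffle0 p (prefix_letter Ld q)
    \<in> Lminus"
proof -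
  have "prefix_letter Ld (shuffle0 p q) - shuffle0 (prefix_letter Ld p) q - shuffle0 p (prefix_letter Ld q)
    = lin_ext (\<lambda>u. lin_ext (\<lambda>v. prefix_letter Ld (shuffle0_word u v)
        - shuffle0_word (Ld # u) v - shuffle0_word u (Ld # v)) q) p"
    unfolding shuffle0_def
    by (simp add: lin_ext_diff_fun rat_linear_lin_ext_fun[OF rat_linear_prefix_letter])
      (simp add: prefix_letter_def lin_ext_lin_ext)
  also have "\<dots> \<in> Lminus"
    using Lminus_generator[of 0] by (intro lin_ext_in_subspace Lminus_subspace) simp
  finally show ?thesis .
qed

text \<open>Prefixing y is left multiplication by y. For d, the elements of \<open>Lminus\<close>
  that stay in it after prefixing d form an ideal by the Leibniz rule, and this ideal contains the
  generators because prefixing d raises their exponent k by one.\<close>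

lemma prefix_letter_Lminus:
  assumes "p \<in> Lminus"
  shows "prefix_letter x p \<in> Lminus"
proof (cases x)
  case Ly
  have "shuffle0_word [Ly] = (\<lambda>v. Poly_Mapping.single (Ly # v) 1)"
    by (simp add: fun_eq_iff prefix_letter_single)
  then have "prefix_letter Ly p = shuffle0 (Poly_Mapping.single [Ly] 1) p"
    by (simp add: shuffle0_def prefix_letter_def del: shuffle0_word.simps)
  then show ?thesis
    using assms two_sided_ideal_Lminus by (auto simp: Ly two_sided_ideal_def)
next
  case Ld
  let ?K = "{p \<in> Lminus. prefix_letter Ld p \<in> Lminus}"
  have sub: "rv.subspace ?K"
    using Lminus_subspace
    by (auto simp: rv.subspace_def rat_linear_zero[OF rat_linear_prefix_letter]
        rat_linear_add[OF rat_linear_prefix_letter] rat_linear_scale[OF rat_linear_prefix_letter])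
  have closed: "shuffle0 r q \<in> Lminus" "shuffle0 q r \<in> Lminus" if "q \<in> Lminus" for r q
    using that two_sided_ideal_Lminus by (auto simp: two_sided_ideal_def)
  have prefix: "prefix_letter Ld (shuffle0 r q) \<in> Lminus"
    if "shuffle0 (prefix_letter Ld r) q \<in> Lminus" "shuffle0 r (prefix_letter Ld q) \<in> Lminus" for r q
    using rv.subspace_add[OF Lminus_subspace rv.subspace_add[OF Lminus_subspace
          shuffle0_Leibniz[of r q] that(2)] that(1)] by simp
  have "two_sided_ideal ?K"
    unfolding two_sided_ideal_def using sub closed prefix by simp
  moreover have "Lminus_generators \<subseteq> ?K"
  proof
    fix r assume "r \<in> Lminus_generators"
    then obtain k u v where r: "r = (prefix_letter Ld ^^ k) (prefix_letter Ld (shuffle0_word u v)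
        - shuffle0_word (Ld # u) v - shuffle0_word u (Ld # v))"
      by (auto simp: Lminus_generators_def)
    show "r \<in> ?K"
      using Lminus_generator[of k u v] Lminus_generator[of "Suc k" u v] by (simp add: r)
  qed
  ultimately have "Lminus \<subseteq> ?K"
    unfolding Lminus_def by (intro hull_minimal)
  with assms show ?thesis by (auto simp: Ld)
qed

lemma prefix_letter_Tminus:
  assumes "p \<in> Tminus"
  shows "prefix_letter x p \<in> Tminus"
proof -
  have "p \<in> {p. prefix_letter x p \<in> Tminus}"
  proof (rule subsetD[OF rv.span_minimal assms[unfolded Tminus_def]])
    show "rv.subspace {p. prefix_letter x p \<in> Tminus}"
      unfolding Tminus_def
      by (auto simp: rv.subspace_def rat_linear_zero[OF rat_linear_prefix_letter]
          rat_linear_add[OF rat_linear_prefix_letter] rat_linear_scale[OF rat_linear_prefix_letter]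
          intro: rv.span_zero rv.span_add rv.span_scale)
    have "Poly_Mapping.single ((x # u) @ [Ld]) 1 \<in> Tminus" for u
      unfolding Tminus_def by (intro rv.span_base) blast
    then show "{Poly_Mapping.single (u @ [Ld]) 1 | u. True} \<subseteq> {p. prefix_letter x p \<in> Tminus}"
      by (auto simp: prefix_letter_single)
  qed
  then show ?thesis by simp
qed

lemma Tminus_subset_Sminus: "Tminus \<subseteq> Sminus"
  using rv.subspace_0[OF Lminus_subspace] by (force simp: Sminus_def)

lemma Lminus_subset_Sminus: "Lminus \<subseteq> Sminus"
  using rv.span_zero by (force simp: Sminus_def Tminus_def)

lemma prefix_letter_Sminus: "p \<in> Sminus \<Longrightarrow> prefix_letter x p \<in> Sminus"
  unfolding Sminus_def
  by clarify (use rat_linear_add[OF rat_linear_prefix_letter] prefix_letter_Tminus prefix_letter_Lminus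
    in blast)

lift_definition letter_op :: "letter \<Rightarrow> H0 \<Rightarrow> H0" is prefix_letter
  by (metis prefix_letter_Sminus rat_linear_minus rat_linear_prefix_letter)

lemma rat_linear_abs_H0: "rat_linear abs_H0"
  by (simp add: rat_linear_iff plus_H0.abs_eq scaleQ_H0.abs_eq)

lemma abs_rep_H0: "abs_H0 (rep_H0 h) = h"
  by (rule Quotient3_abs_rep[OF Quotient3_H0])

lemma rat_linear_letter_op: "rat_linear (letter_op x)"
proof -
  have "letter_op x (abs_H0 p + c *\<^sub>Q abs_H0 q) = letter_op x (abs_H0 p) + c *\<^sub>Q letter_op x (abs_H0 q)"
    for p q c
    by (simp add: plus_H0.abs_eq scaleQ_H0.abs_eq letter_op.abs_eq
        rat_linear_add[OF rat_linear_prefix_letter] rat_linear_scale[OF rat_linear_prefix_letter])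
  then have *: "letter_op x (g + c *\<^sub>Q h) = letter_op x g + c *\<^sub>Q letter_op x h" for g h c
    by (metis abs_rep_H0)
  \<comment> \<open>The choice c = -1 gives the value at 0; then c = 1 gives additivity and g = 0
    homogeneity.\<close>
  have "letter_op x 0 = 0"
    using *[of 0 "-1" 0] by simp
  then show ?thesis
    unfolding rat_linear_iff using *[of _ 1] *[of 0] by (simp add: scaleQ_one)
qed

lemma letter_op_cls: "letter_op x (cls u) = cls (x # u)"
  by (simp add: cls.abs_eq letter_op.abs_eq prefix_letter_single)

lemma cls_not_Ywords:
  assumes "u \<notin> Ywords"
  shows "cls u = 0"
proof -
  obtain v where u: "u = v @ [Ld]"
  proof (cases u rule: rev_cases)
    case (snoc v x)
    with assms that show ?thesis by (cases x) (auto simp: Ywords_def)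
  qed (use assms in \<open>auto simp: Ywords_def\<close>)
  have "Poly_Mapping.single u 1 \<in> Sminus"
    using Tminus_subset_Sminus unfolding u Tminus_def by (blast intro: rv.span_base)
  then show ?thesis by (simp add: cls.abs_eq zero_H0_def H0.abs_eq_iff)
qed

lemma H0_eqI:
  assumes "rat_linear f" "rat_linear g" "\<And>u. u \<in> Ywords \<Longrightarrow> f (cls u) = g (cls u)"
  shows "f h = g h"
proof -
  have agree: "f (cls u) = g (cls u)" for u
    using assms(3)[of u] cls_not_Ywords[of u] rat_linear_zero[OF assms(1)] rat_linear_zero[OF assms(2)]
    by (cases "u \<in> Ywords") auto
  have "f (abs_H0 (rep_H0 h)) = g (abs_H0 (rep_H0 h))"
  proof (rule rat_linear_eqI_single[where f = "\<lambda>p. f (abs_H0 p)" and g = "\<lambda>p. g (abs_H0 p)"])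
    show "f (abs_H0 (Poly_Mapping.single u 1)) = g (abs_H0 (Poly_Mapping.single u 1))" for u
      using agree[of u] by (simp add: cls.abs_eq)
  qed (rule rat_linear_compose[OF assms(1) rat_linear_abs_H0]
      rat_linear_compose[OF assms(2) rat_linear_abs_H0])+
  then show ?thesis by (simp add: abs_rep_H0)
qed

text \<open>The generator with k = 0 says that, modulo \<open>Lminus\<close>, multiplication by du
  is the commutator of prefixing d with multiplication by u. For u = \<open>dy n\<close> this is the
  induction step.\<close>

lemma iter_ad_letter_op_cls:
  "iter_ad (letter_op Ld) (letter_op Ly) n (cls v) = abs_H0 (shuffle0_word (dy n) v)"
proof (induction n arbitrary: v)
  case 0
  show ?case by (simp add: dy_def letter_op_cls prefix_letter_single flip: cls.abs_eq)
next
  case (Suc n)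
  have "prefix_letter Ld (shuffle0_word (dy n) v) - shuffle0_word (Ld # dy n) v
      - shuffle0_word (dy n) (Ld # v) \<in> Sminus"
    using Lminus_generator[of 0 "dy n" v] Lminus_subset_Sminus by auto
  then have "abs_H0 (prefix_letter Ld (shuffle0_word (dy n) v) - shuffle0_word (dy n) (Ld # v)) =
      abs_H0 (shuffle0_word (Ld # dy n) v)"
    by (simp add: H0.abs_eq_iff algebra_simps)
  then show ?case
    by (simp add: Suc.IH letter_op_cls letter_op.abs_eq rat_linear_minus[OF rat_linear_abs_H0] dy_def)
qed

text \<open>By \<open>iter_ad_letter_op_cls\<close> the commutation is the clause of the product
  that pulls y out of the right factor, for left factor d^n y.\<close>

lemma derivation_pair_letter_op: "derivation_pair (letter_op Ld) (letter_op Ly)"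
proof (rule derivation_pair.intro)
  fix n t
  let ?L = "iter_ad (letter_op Ld) (letter_op Ly) n"
  have lin: "rat_linear ?L"
    by (intro rat_linear_iter_ad rat_linear_letter_op)
  show "letter_op Ly (?L t) = ?L (letter_op Ly t)"
  proof (rule H0_eqI[where f = "\<lambda>t. letter_op Ly (?L t)"])
    show "rat_linear (\<lambda>t. letter_op Ly (?L t))" "rat_linear (\<lambda>t. ?L (letter_op Ly t))"
      by (rule rat_linear_compose[OF rat_linear_letter_op lin] rat_linear_compose[OF lin rat_linear_letter_op])+
    show "letter_op Ly (?L (cls u)) = ?L (letter_op Ly (cls u))" for u
      by (simp add: letter_op_cls iter_ad_letter_op_cls shuffle0_word_y_right letter_op.abs_eq)
  qed
qed (rule rat_linear_letter_op)+


section \<open>Distributing the letters of a word over two subwords\<close>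

section \<open>Sums over splittings of a word\<close>

text \<open>The sum over pairs of complementary subwords, in recursive form;
  \<open>split_sum_nths\<close> recovers the sum over sets of positions.\<close>

primrec split_sum :: "'a list \<Rightarrow> ('a list \<Rightarrow> 'a list \<Rightarrow> 'b::comm_monoid_add) \<Rightarrow> 'b"
  where
    "split_sum [] = (\<lambda>G. G [] [])"
  | "split_sum (x # w) = (\<lambda>G. split_sum w (\<lambda>a b. G (x # a) b + G a (x # b)))"

lemma split_sum_add: "split_sum w (\<lambda>a b. G a b + H a b) = split_sum w G + split_sum w H"
proof (induction w arbitrary: G H)
  case (Cons x w)
  show ?case by (simp add: Cons.IH[symmetric] ac_simps)
qed simp

lemma split_sum_swap: "split_sum w (\<lambda>a b. G b a) = split_sum w G"
proof (induction w arbitrary: G)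
  case (Cons x w)
  show ?case
    using Cons.IH[of "\<lambda>a b. G (x # a) b"] Cons.IH[of "\<lambda>a b. G a (x # b)"]
    by (simp add: split_sum_add add.commute)
qed simp

lemma split_sum_append:
  "split_sum (u @ v) G = split_sum u (\<lambda>a b. split_sum v (\<lambda>a' b'. G (a @ a') (b @ b')))"
  by (induction u arbitrary: G) (simp_all add: split_sum_add)

lemma split_sum_linear:
  assumes "rat_linear h"
  shows "h (split_sum w G) = split_sum w (\<lambda>a b. h (G a b))"
  by (induction w arbitrary: G) (simp_all add: rat_linear_add[OF assms])

lemma split_sum_nths:
  "split_sum w G = (\<Sum>S\<in>Pow {..<length w}. G (nths w S) (nths w ({..<length w} - S)))"
proof (induction w arbitrary: G)
  case (Cons x w)
  let ?n = "length w"
  let ?F = "\<lambda>S. G (nths (x # w) S) (nths (x # w) ({..<Suc ?n} - S))"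
  have img: "Pow {..<Suc ?n} = (`) Suc ` Pow {..<?n} \<union> insert 0 ` (`) Suc ` Pow {..<?n}"
    by (simp add: lessThan_Suc_eq_insert_0 Pow_insert image_Pow_surj[OF refl])
  have inj: "inj_on ((`) Suc) (Pow {..<?n})" "inj_on (insert 0) ((`) Suc ` Pow {..<?n})"
    by (auto simp: inj_on_def inj_image_eq_iff)
  have F: "?F (Suc ` T) = G (nths w T) (x # nths w ({..<?n} - T))"
    "?F (insert 0 (Suc ` T)) = G (x # nths w T) (nths w ({..<?n} - T))" for T
  proof -
    have "{j. j \<in> T} = T" "{j. j < ?n \<and> j \<notin> T} = {..<?n} - T" by auto
    then show "?F (Suc ` T) = G (nths w T) (x # nths w ({..<?n} - T))"
      "?F (insert 0 (Suc ` T)) = G (x # nths w T) (nths w ({..<?n} - T))"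
      by (simp_all add: nths_Cons inj_image_mem_iff)
  qed
  have "(\<Sum>S\<in>Pow {..<Suc ?n}. ?F S) =
    (\<Sum>S\<in>(`) Suc ` Pow {..<?n}. ?F S) + (\<Sum>S\<in>insert 0 ` (`) Suc ` Pow {..<?n}. ?F S)"
    unfolding img by (rule sum.union_disjoint) auto
  also have "\<dots> = (\<Sum>T\<in>Pow {..<?n}. ?F (Suc ` T)) + (\<Sum>T\<in>Pow {..<?n}. ?F (insert 0 (Suc ` T)))"
    by (simp only: sum.reindex[OF inj(1)] sum.reindex[OF inj(2)] o_def)
  finally show ?case
    by (simp add: F Cons.IH sum.distrib[symmetric] add.commute)
qed simp

lemma sum_pairs_add_eq:
  "(\<Sum>(i, j) | i + j = (m::nat). F i j) = (\<Sum>i\<le>m. F i (m - i))"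
  by (rule sum.reindex_bij_witness[where i = "\<lambda>i. (i, m - i)" and j = fst]) auto

text \<open>As the letters are equal, only the number i of those going left matters, with binomial
  multiplicity. The induction is Pascal's rule.\<close>

lemma split_sum_dpow:
  fixes G :: "word \<Rightarrow> word \<Rightarrow> 'b::rat_vector"
  shows "split_sum (dpow m) G = (\<Sum>i\<le>m. of_nat (m choose i) *\<^sub>Q G (dpow i) (dpow (m - i)))"
proof (induction m arbitrary: G)
  case (Suc m)
  let ?g = "\<lambda>i. G (dpow i) (dpow (Suc m - i))"
  have "split_sum (dpow (Suc m)) G =
      (\<Sum>i\<le>m. of_nat (m choose i) *\<^sub>Q ?g (Suc i)) + (\<Sum>i\<le>m. of_nat (m choose i) *\<^sub>Q ?g i)"
    by (simp add: Suc.IH scaleQ_add_right sum.distrib Suc_diff_le)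
  \<comment> \<open>The added term i = m + 1 has coefficient 0; once i = 0 is split off, both sums
    run over \<open>?g (Suc i)\<close>.\<close>
  also have "(\<Sum>i\<le>m. of_nat (m choose i) *\<^sub>Q ?g i) = (\<Sum>i\<le>Suc m. of_nat (m choose i) *\<^sub>Q ?g i)"
    by (simp add: rv.scale_zero_left)
  also have "\<dots> = ?g 0 + (\<Sum>i\<le>m. of_nat (m choose Suc i) *\<^sub>Q ?g (Suc i))"
    by (subst sum.atMost_Suc_shift) (simp add: scaleQ_one)
  also have "(\<Sum>i\<le>m. of_nat (m choose i) *\<^sub>Q ?g (Suc i)) + \<dots> =
      ?g 0 + (\<Sum>i\<le>m. of_nat (Suc m choose Suc i) *\<^sub>Q ?g (Suc i))"
    by (simp add: scaleQ_add_left sum.distrib)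
  also have "\<dots> = (\<Sum>i\<le>Suc m. of_nat (Suc m choose i) *\<^sub>Q ?g i)"
    by (subst sum.atMost_Suc_shift) (simp add: scaleQ_one)
  finally show ?case .
qed (simp add: scaleQ_one)

lemma split_sum_dy:
  fixes G :: "word \<Rightarrow> word \<Rightarrow> 'b::rat_vector"
  shows "split_sum (dy m) G =
    (\<Sum>(i, j) | i + j = m. of_nat (m choose i) *\<^sub>Q G (dy i) (dpow j)) +
    (\<Sum>(i, j) | i + j = m. of_nat (m choose i) *\<^sub>Q G (dpow i) (dy j))"
  by (simp add: dy_def split_sum_append split_sum_dpow sum_pairs_add_eq scaleQ_add_right sum.distrib)

lemma sum_pairs_binomial_swap:
  "(\<Sum>(i, j) | i + j = m. of_nat (m choose i) *\<^sub>Q F i j) =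
    (\<Sum>(i, j) | i + j = m. of_nat (m choose i) *\<^sub>Q F j i)"
proof -
  have "i + j choose j = (i + j choose i)" for i j
    using binomial_symmetric[of i "i + j"] by simp
  then show ?thesis
    by (intro sum.reindex_bij_witness[where i = prod.swap and j = prod.swap]) auto
qed


section \<open>Existence of the coproduct and its values on words\<close>

section \<open>The coproduct\<close>

text \<open>The classes of \<open>Ywords\<close> span the quotient, so a linear map with the given
  values is unique and \<open>THE\<close> selects it.\<close>

lemma linear_from_Ywords_eqI:
  assumes "rat_linear f" "\<And>w. w \<in> Ywords \<Longrightarrow> f (cls w) = g w"
  shows "linear_from_Ywords g = f"
  unfolding linear_from_Ywords_def
proof (rule the_equality)
  fix f' assume "rat_linear f' \<and> (\<forall>w\<in>Ywords. f' (cls w) = g w)"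
  with assms have "f' h = f h" for h
    by - (rule H0_eqI[of f' f], auto)
  then show "f' = f" by (rule ext)
qed (use assms in auto)

definition coproduct_word :: "word \<Rightarrow> (H0, H0) tensor"
  where "coproduct_word w = split_sum w (\<lambda>a b. cls a \<otimes> cls b)"

lemma tensor_cls_eq_0: "a \<notin> Ywords \<or> b \<notin> Ywords \<Longrightarrow> cls a \<otimes> cls b = 0"
  by (auto simp: cls_not_Ywords rat_linear_zero[OF rat_linear_tensor_left]
      rat_linear_zero[OF rat_linear_tensor_right])

lemma coproduct_word_conv_sum:
  "coproduct_word w =
    (\<Sum>S | S \<subseteq> {..<length w} \<and> nths w S \<in> Ywords \<and> nths w ({..<length w} - S) \<in> Ywords.
      cls (nths w S) \<otimes> cls (nths w ({..<length w} - S)))"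
  unfolding coproduct_word_def split_sum_nths
  by (rule sum.mono_neutral_right) (auto intro!: tensor_cls_eq_0)

lemma linear_coproduct_ex: "\<exists>f. rat_linear f \<and> (\<forall>w. f (cls w) = coproduct_word w)"
proof -
  interpret D: derivation_pair "diag_op (letter_op Ld)" "diag_op (letter_op Ly)"
    by (rule derivation_pair_diag_op[OF derivation_pair_letter_op])
  let ?one = "cls [] \<otimes> cls []"
  \<comment> \<open>A representative acts on the unit of the tensor square;
    \<open>act_lin_Sminus\<close> makes the result independent of the representative.\<close>
  define f where "f = (\<lambda>h. D.act_lin (rep_H0 h) ?one)"
  have f_abs: "f (abs_H0 p) = D.act_lin p ?one" for p
  proof -
    have "rep_H0 (abs_H0 p) - p \<in> Sminus"
      by (simp add: abs_rep_H0 flip: H0.abs_eq_iff)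
    from D.act_lin_Sminus[OF this, of ?one] show ?thesis
      by (simp add: f_def D.act_lin_minus)
  qed
  have "f (abs_H0 p + abs_H0 q) = f (abs_H0 p) + f (abs_H0 q)"
    "f (c *\<^sub>Q abs_H0 p) = c *\<^sub>Q f (abs_H0 p)" for p q c
    by (simp_all add: plus_H0.abs_eq scaleQ_H0.abs_eq f_abs D.act_lin_def
        rat_linear_add[OF rat_linear_lin_ext] rat_linear_scale[OF rat_linear_lin_ext])
  then have "rat_linear f"
    unfolding rat_linear_iff by (metis abs_rep_H0)
  moreover have "f (cls w) = coproduct_word w" for w
  proof -
    note lin = rat_linear_diag_op[OF rat_linear_letter_op]
    \<comment> \<open>The word d is 0 in \<open>H0\<close>, so the diagonal operator of d kills
      \<open>?one\<close>. The subtracted term of each commutator vanishes there, and words act on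
      \<open>?one\<close> letter by letter, as in the recursion of \<open>split_sum\<close>.\<close>
    have "letter_op Ld (cls []) = 0"
      using cls_not_Ywords[of "[Ld]"] by (simp add: letter_op_cls Ywords_def)
    then have zero: "diag_op (letter_op Ld) ?one = 0"
      by (simp add: diag_op_elem rat_linear_letter_op rat_linear_zero[OF rat_linear_tensor_left]
          rat_linear_zero[OF rat_linear_tensor_right])
    have "D.act w ?one = coproduct_word w"
    proof (induction w)
      case (Cons x w)
      have "D.act (x # w) ?one = diag_op (letter_op x) (D.act w ?one)"
        by (cases x) (simp_all add: zero rat_linear_zero[OF D.linear_act])
      also have "\<dots> = coproduct_word (x # w)"
        by (simp add: Cons.IH coproduct_word_def split_sum_linear[OF lin]
            diag_op_elem[OF rat_linear_letter_op] letter_op_cls)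
      finally show ?case .
    qed (simp add: coproduct_word_def)
    then show ?thesis by (simp add: cls.abs_eq f_abs)
  qed
  ultimately show ?thesis by blast
qed

lemma rat_linear_coproduct0: "rat_linear coproduct0"
  and coproduct0_cls: "coproduct0 (cls w) = coproduct_word w"
proof -
  obtain f where f: "rat_linear f" "\<And>w. f (cls w) = coproduct_word w"
    using linear_coproduct_ex by blast
  have "coproduct0 = f"
    unfolding coproduct0_def
    by (rule linear_from_Ywords_eqI) (simp_all add: f coproduct_word_conv_sum)
  with f show "rat_linear coproduct0" "coproduct0 (cls w) = coproduct_word w" by auto
qed

lemma reduced_coproduct0_cls:
  "reduced_coproduct0 (cls w) = coproduct_word w - cls [] \<otimes> cls w - cls w \<otimes> cls []"
proof -
  have "reduced_coproduct0 = (\<lambda>h. coproduct0 h - cls [] \<otimes> h - h \<otimes> cls [])"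
    unfolding reduced_coproduct0_def
  proof (rule linear_from_Ywords_eqI)
    show "rat_linear (\<lambda>h. coproduct0 h - cls [] \<otimes> h - h \<otimes> cls [])"
      by (rule rat_linear_minus_fun[OF rat_linear_minus_fun[OF rat_linear_coproduct0
            rat_linear_tensor_right] rat_linear_tensor_left])
  qed simp
  from fun_cong[OF this, of "cls w"] show ?thesis by (simp only: coproduct0_cls)
qed


section \<open>Splittings of a product of blocks, sorted by the last y on each side\<close>

section \<open>Words in the letters \<open>dy m\<close>\<close>

lemma dys_Cons: "a \<le> b \<Longrightarrow> dys k a b = dy (k a) @ dys k (Suc a) b"
  by (simp add: dys_def upt_conv_Cons del: upt_Suc)

lemma dys_snoc: "a \<le> Suc b \<Longrightarrow> dys k a (Suc b) = dys k a b @ dy (k (Suc b))"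
  by (simp add: dys_def)

lemma dys_empty: "b < a \<Longrightarrow> dys k a b = []"
  by (simp add: dys_def)

context
  fixes G :: "word \<Rightarrow> word \<Rightarrow> 'b::rat_vector"
  assumes vanish: "\<And>a b. a \<notin> Ywords \<Longrightarrow> G a b = 0"
begin

text \<open>When the y of a block goes right, a d of the block kept on the left would end the left
  word and make the term vanish; only i = 0 survives.\<close>

lemma sum_dpow_left:
  "(\<Sum>(i, j) | i + j = m. of_nat (m choose i) *\<^sub>Q G (a @ dpow i) (b @ dy j @ r)) = G a (b @ dy m @ r)"
proof -
  have "G (a @ dpow i) w = 0" if "i > 0" for i w
  proof (rule vanish)
    have "last (a @ dpow i) = Ld" "a @ dpow i \<noteq> []" using that by simp_all
    then show "a @ dpow i \<notin> Ywords" by (auto simp: Ywords_def)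
  qed
  then have "(\<Sum>i\<le>m. of_nat (m choose i) *\<^sub>Q G (a @ dpow i) (b @ dy (m - i) @ r)) =
    (\<Sum>i\<le>m. if i = 0 then G a (b @ dy m @ r) else 0)"
    by (intro sum.cong) (auto simp: scaleQ_one rv.scale_zero_right)
  then show ?thesis by (simp add: sum_pairs_add_eq)
qed

text \<open>Case distinction on the y of block p + 1. If it goes right, the whole block does by
  \<open>sum_dpow_left\<close>; if it goes left, it is the last y on the left.\<close>

lemma split_sum_dys_step:
  assumes "Suc p \<le> n"
  shows "split_sum (dys k 1 (Suc p)) (\<lambda>a b. G a (b @ dys k (Suc (Suc p)) n)) =
    split_sum (dys k 1 p) (\<lambda>a b. G a (b @ dys k (Suc p) n)) +
    split_sum (dys k 1 p) (\<lambda>a b. \<Sum>(i, j) | i + j = k (Suc p). of_nat (k (Suc p) choose i) *\<^sub>Q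
      G (a @ dy i) (b @ dpow j @ dys k (Suc (Suc p)) n))"
  using assms
  by (simp add: dys_snoc split_sum_append split_sum_dy sum_dpow_left dys_Cons[of "Suc p"]
      split_sum_add add.commute)

text \<open>Iterating the step, index p collects the terms whose last left y is in block p + 1. The
  isolated term has no y on the left.\<close>

lemma split_sum_dys_prefix:
  assumes "q \<le> n"
  shows "split_sum (dys k 1 q) (\<lambda>a b. G a (b @ dys k (Suc q) n)) =
    G [] (dys k 1 n) +
    (\<Sum>p<q. split_sum (dys k 1 p) (\<lambda>a b. \<Sum>(i, j) | i + j = k (Suc p). of_nat (k (Suc p) choose i) *\<^sub>Q
      G (a @ dy i) (b @ dpow j @ dys k (Suc (Suc p)) n)))"
  using assms
proof (induction q)
  case 0
  show ?case by (simp add: dys_empty)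
next
  case (Suc q)
  then show ?case
    using split_sum_dys_step[OF Suc.prems, of k] by (simp add: add.assoc)
qed

end

text \<open>The final y goes right or left. The side without it is governed by
  \<open>split_sum_dys_prefix\<close>, applied to \<open>G\<close> or, after exchanging the sides,
  to \<open>?G'\<close>.\<close>

lemma split_sum_dys:
  fixes G :: "word \<Rightarrow> word \<Rightarrow> 'b::rat_vector"
  assumes vanish: "\<And>a b. a \<notin> Ywords \<or> b \<notin> Ywords \<Longrightarrow> G a b = 0"
  shows "split_sum (dys k 1 (Suc q)) G = G [] (dys k 1 (Suc q)) + G (dys k 1 (Suc q)) [] +
    (\<Sum>p<q. split_sum (dys k 1 p) (\<lambda>a b. \<Sum>(i, j) | i + j = k (Suc p). of_nat (k (Suc p) choose i) *\<^sub>Q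
      (G (a @ dy i) (b @ dpow j @ dys k (Suc (Suc p)) (Suc q)) +
       G (b @ dpow j @ dys k (Suc (Suc p)) (Suc q)) (a @ dy i))))"
proof -
  let ?n = "Suc q" and ?m = "k (Suc q)"
  let ?G' = "\<lambda>a b. G b a"
  have vanish': "a \<notin> Ywords \<Longrightarrow> G a b = 0" "a \<notin> Ywords \<Longrightarrow> ?G' a b = 0" for a b
    using vanish by auto
  have "(\<Sum>(i, j) | i + j = ?m. of_nat (?m choose i) *\<^sub>Q G (a @ dpow i) (b @ dy j)) = G a (b @ dy ?m)" for a b
    using sum_dpow_left[of G ?m a b "[]"] vanish'(1) by simp
  \<comment> \<open>With the final y on the left, i and j must trade places before
    \<open>sum_dpow_left\<close> applies to \<open>?G'\<close>.\<close>
  moreover have "(\<Sum>(i, j) | i + j = ?m. of_nat (?m choose i) *\<^sub>Q G (a @ dy i) (b @ dpow j)) = G (a @ dy ?m) b" for a b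
    using sum_dpow_left[of ?G' ?m b a "[]"] vanish'(2)
    by (subst sum_pairs_binomial_swap) simp
  ultimately have "split_sum (dys k 1 ?n) G =
      split_sum (dys k 1 q) (\<lambda>a b. G a (b @ dy ?m)) + split_sum (dys k 1 q) (\<lambda>a b. G (a @ dy ?m) b)"
    by (simp add: dys_snoc split_sum_append split_sum_dy split_sum_add add.commute)
  also have "split_sum (dys k 1 q) (\<lambda>a b. G (a @ dy ?m) b) =
      split_sum (dys k 1 q) (\<lambda>a b. ?G' a (b @ dy ?m))"
    by (rule split_sum_swap[symmetric])
  also have "dy ?m = dys k (Suc q) ?n"
    by (simp add: dys_Cons dys_empty)
  finally show ?thesis
    using split_sum_dys_prefix[of G q ?n k, OF vanish'(1)] split_sum_dys_prefix[of ?G' q ?n k, OF vanish'(2)]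
    by (simp add: scaleQ_add_right sum.distrib split_sum_add case_prod_beta ac_simps)
qed


section \<open>Sums over splittings and choices, and the formula\<close>

section \<open>Extending families of pairs\<close>

text \<open>The common form of \<open>splittings\<close> and \<open>uv_choices\<close>, so that one
  extension lemma serves both.\<close>

definition pair_families :: "(nat \<Rightarrow> 'a \<Rightarrow> 'b \<Rightarrow> bool) \<Rightarrow> nat \<Rightarrow> ((nat \<Rightarrow> 'a) \<times> (nat \<Rightarrow> 'b)) set"
  where "pair_families R m = {(f, g). f \<in> {1..m} \<rightarrow>\<^sub>E UNIV \<and> g \<in> {1..m} \<rightarrow>\<^sub>E UNIV \<and>
    (\<forall>q\<in>{1..m}. R q (f q) (g q))}"

lemma sum_pair_families_Suc:
  "(\<Sum>(f, g)\<in>pair_families R (Suc m). F f g) =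
    (\<Sum>(f, g)\<in>pair_families R m. \<Sum>(x, y) | R (Suc m) x y. F (f(Suc m := x)) (g(Suc m := y)))"
proof -
  let ?r = "\<lambda>((f, g), (x, y)). (f(Suc m := x), g(Suc m := y))"
  \<comment> \<open>Families are extensional: removing the entry at m + 1 means resetting it to
    \<open>undefined\<close>.\<close>
  let ?s = "\<lambda>(f, g). ((f(Suc m := undefined), g(Suc m := undefined)), (f (Suc m), g (Suc m)))"
  have "(\<Sum>(f, g)\<in>pair_families R (Suc m). F f g) =
    (\<Sum>((f, g), (x, y))\<in>pair_families R m \<times> {(x, y). R (Suc m) x y}. F (f(Suc m := x)) (g(Suc m := y)))"
    by (rule sum.reindex_bij_witness[where i = ?r and j = ?s])
      (auto simp: pair_families_def PiE_iff extensional_def fun_eq_iff Ball_def le_Suc_eq)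
  also have "\<dots> = (\<Sum>fg\<in>pair_families R m. \<Sum>(x, y) | R (Suc m) x y. F ((fst fg)(Suc m := x)) ((snd fg)(Suc m := y)))"
    by (simp add: sum.cartesian_product case_prod_beta)
  finally show ?thesis by (simp add: case_prod_beta)
qed

lemma splittings_eq: "splittings k p = pair_families (\<lambda>a x y. x + y = k a) p"
  by (simp add: splittings_def pair_families_def)

lemma uv_choices_eq: "uv_choices i j m = pair_families
    (\<lambda>q x y. (x, y) = (dpow (i q), dy (j q)) \<or> (x, y) = (dy (j q), dpow (i q))) m"
  by (simp add: uv_choices_def pair_families_def)

lemma sum_splittings_Suc:
  "(\<Sum>(i, j)\<in>splittings k (Suc p). F i j) =
    (\<Sum>(i, j)\<in>splittings k p. \<Sum>(x, y) | x + y = k (Suc p). F (i(Suc p := x)) (j(Suc p := y)))"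
  unfolding splittings_eq by (rule sum_pair_families_Suc)

text \<open>Makes the two choices for a pair distinct, so that a sum over the set of choices counts
  both.\<close>

lemma dpow_neq_dy: "dpow i \<noteq> dy j"
proof
  assume "dpow i = dy j"
  then have "Ly \<in> set (dpow i)" by (simp add: dy_def)
  then show False by simp
qed

lemma sum_uv_choices_Suc:
  "(\<Sum>(u, v)\<in>uv_choices i j (Suc m). F u v) = (\<Sum>(u, v)\<in>uv_choices i j m.
    F (u(Suc m := dy (j (Suc m)))) (v(Suc m := dpow (i (Suc m)))) +
    F (u(Suc m := dpow (i (Suc m)))) (v(Suc m := dy (j (Suc m)))))"
proof -
  let ?i = "i (Suc m)" and ?j = "j (Suc m)"
  have "{(x, y). (x, y) = (dpow ?i, dy ?j) \<or> (x, y) = (dy ?j, dpow ?i)} =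
    {(dy ?j, dpow ?i), (dpow ?i, dy ?j)}"
    by auto
  then show ?thesis
    unfolding uv_choices_eq sum_pair_families_Suc
    by (simp add: dpow_neq_dy[symmetric])
qed

text \<open>The last block of the formula is split but offers no choice of (u, v). Its splitting can
  move inside because the choices depend on the first p entries only.\<close>

lemma sum_splittings_uv_choices_snoc:
  fixes H :: "word \<Rightarrow> word \<Rightarrow> nat \<Rightarrow> nat \<Rightarrow> 'b::rat_vector"
  shows "(\<Sum>(i, j)\<in>splittings k (Suc p). (\<Prod>a = 1..Suc p. of_nat (k a choose i a)) *\<^sub>Q
      (\<Sum>(u, v)\<in>uv_choices i j p. H (concat (map u [1..<Suc p])) (concat (map v [1..<Suc p])) (i (Suc p)) (j (Suc p)))) =
    (\<Sum>(i, j)\<in>splittings k p. (\<Prod>a = 1..p. of_nat (k a choose i a)) *\<^sub>Q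
      (\<Sum>(u, v)\<in>uv_choices i j p. \<Sum>(x, y) | x + y = k (Suc p). of_nat (k (Suc p) choose x) *\<^sub>Q
        H (concat (map u [1..<Suc p])) (concat (map v [1..<Suc p])) x y))"
proof -
  have uv: "uv_choices (i(Suc p := x)) (j(Suc p := y)) p = uv_choices i j p" for i j x y
    by (simp add: uv_choices_def)
  have pr: "(\<Prod>a = 1..Suc p. of_nat (k a choose (i(Suc p := x)) a) :: rat) =
    (\<Prod>a = 1..p. of_nat (k a choose i a)) * of_nat (k (Suc p) choose x)" for i x
    by simp
  have sw: "(\<Sum>(u, v)\<in>uv_choices i j p. \<Sum>(x, y) | x + y = k (Suc p). of_nat (k (Suc p) choose x) *\<^sub>Q
        H (concat (map u [1..<Suc p])) (concat (map v [1..<Suc p])) x y) =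
     (\<Sum>(x, y) | x + y = k (Suc p). of_nat (k (Suc p) choose x) *\<^sub>Q (\<Sum>(u, v)\<in>uv_choices i j p.
        H (concat (map u [1..<Suc p])) (concat (map v [1..<Suc p])) x y))" for i j
    unfolding case_prod_beta rv.scale_sum_right by (rule sum.swap)
  show ?thesis
    unfolding sum_splittings_Suc uv pr sw
    by (simp add: case_prod_beta rv.scale_sum_right scaleQ_scaleQ del: upt_Suc)
qed

text \<open>Each block breaks into a piece without y and a piece with y; u and v record which side
  gets which.\<close>

lemma split_sum_dys_choices:
  fixes H :: "word \<Rightarrow> word \<Rightarrow> 'b::rat_vector"
  shows "split_sum (dys k 1 p) H =
    (\<Sum>(i, j)\<in>splittings k p. (\<Prod>a = 1..p. of_nat (k a choose i a)) *\<^sub>Q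
      (\<Sum>(u, v)\<in>uv_choices i j p. H (concat (map u [1..<Suc p])) (concat (map v [1..<Suc p]))))"
proof (induction p arbitrary: H)
  case 0
  have "splittings k 0 = {(\<lambda>_. undefined, \<lambda>_. undefined)}"
    "uv_choices i j 0 = {(\<lambda>_. undefined, \<lambda>_. undefined)}" for i j
    by (auto simp: splittings_def uv_choices_def)
  then show ?case by (simp add: dys_empty scaleQ_one)
next
  case (Suc p)
  let ?K = "\<lambda>a b x y. H (a @ dy y) (b @ dpow x) + H (a @ dpow x) (b @ dy y)"
  have upd: "concat (map (u(Suc p := w)) [1..<Suc (Suc p)]) = concat (map u [1..<Suc p]) @ w" for u w
    by (simp add: upt_Suc_append del: upt_Suc)
  have "split_sum (dys k 1 (Suc p)) H = split_sum (dys k 1 p) (\<lambda>a b.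
      \<Sum>(x, y) | x + y = k (Suc p). of_nat (k (Suc p) choose x) *\<^sub>Q ?K a b x y)"
  proof -
    \<comment> \<open>In \<open>?K\<close> the number x counts the d's of the piece without y, on
      whichever side; where y goes left this takes the binomial symmetry.\<close>
    have "split_sum (dy (k (Suc p))) (\<lambda>a' b'. H (a @ a') (b @ b')) =
      (\<Sum>(x, y) | x + y = k (Suc p). of_nat (k (Suc p) choose x) *\<^sub>Q ?K a b x y)" for a b
      using sum_pairs_binomial_swap[of "k (Suc p)" "\<lambda>x y. H (a @ dy x) (b @ dpow y)"]
      by (simp add: split_sum_dy sum_pairs_add_eq scaleQ_add_right sum.distrib)
    then show ?thesis by (simp add: dys_snoc split_sum_append)
  qed
  also have "\<dots> = (\<Sum>(i, j)\<in>splittings k (Suc p). (\<Prod>a = 1..Suc p. of_nat (k a choose i a)) *\<^sub>Q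
      (\<Sum>(u, v)\<in>uv_choices i j p. ?K (concat (map u [1..<Suc p])) (concat (map v [1..<Suc p])) (i (Suc p)) (j (Suc p))))"
    unfolding Suc.IH by (rule sum_splittings_uv_choices_snoc[where H = ?K, symmetric])
  finally show ?case
    by (simp only: sum_uv_choices_Suc upd)
qed

theorem proposition2p5:
  fixes n :: nat and k :: "nat \<Rightarrow> nat"
  assumes "n \<ge> 2"
  shows "reduced_coproduct0 (cls (dys k 1 n)) =
    (\<Sum>(i, j) | i + j = k 1.
       of_nat (k 1 choose i) *\<^sub>Q (dy i \<otimes>\<^sub>s\<^sub>y\<^sub>m (dpow j @ dys k 2 n)))
    + (\<Sum>p = 2..n - 1. \<Sum>(i, j)\<in>splittings k p.
        (\<Prod>a = 1..p. of_nat (k a choose i a)) *\<^sub>Q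
          (\<Sum>(u, v)\<in>uv_choices i j (p - 1).
            (concat (map u [1..<p]) @ dy (i p)) \<otimes>\<^sub>s\<^sub>y\<^sub>m
            (concat (map v [1..<p]) @ dpow (j p) @ dys k (p + 1) n)))"
proof -
  obtain q where n: "n = Suc (Suc q)"
    using assms by (metis Suc_le_D numeral_2_eq_2 Suc_le_mono)
  \<comment> \<open>\<open>?T p\<close> collects the terms in which the side without the final y has
    its last y in block p + 1; the index is one less than p in the formula.\<close>
  let ?T = "\<lambda>p. split_sum (dys k 1 p) (\<lambda>a b. \<Sum>(i, j) | i + j = k (Suc p). of_nat (k (Suc p) choose i) *\<^sub>Q
      ((a @ dy i) \<otimes>\<^sub>s\<^sub>y\<^sub>m (b @ dpow j @ dys k (Suc (Suc p)) n)))"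
  have "coproduct_word (dys k 1 n) = cls [] \<otimes> cls (dys k 1 n) + cls (dys k 1 n) \<otimes> cls [] + (\<Sum>p<Suc q. ?T p)"
    unfolding coproduct_word_def tensor_sym_def n by (rule split_sum_dys) (rule tensor_cls_eq_0)
  \<comment> \<open>The reduced coproduct removes the two terms with an empty side.
    \<open>?T 0\<close>, with no earlier blocks, is the first sum of the formula.\<close>
  then have "reduced_coproduct0 (cls (dys k 1 n)) = ?T 0 + (\<Sum>p<q. ?T (Suc p))"
    by (simp only: reduced_coproduct0_cls sum.lessThan_Suc_shift) simp
  also have "(\<Sum>p<q. ?T (Suc p)) = (\<Sum>p = 2..n - 1. ?T (p - 1))"
    by (rule sum.reindex_bij_witness[where i = "\<lambda>p. p - 2" and j = "\<lambda>p. p + 2"]) (auto simp: n)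
  also have "\<dots> = (\<Sum>p = 2..n - 1. \<Sum>(i, j)\<in>splittings k p.
        (\<Prod>a = 1..p. of_nat (k a choose i a)) *\<^sub>Q
          (\<Sum>(u, v)\<in>uv_choices i j (p - 1).
            (concat (map u [1..<p]) @ dy (i p)) \<otimes>\<^sub>s\<^sub>y\<^sub>m
            (concat (map v [1..<p]) @ dpow (j p) @ dys k (p + 1) n)))"
  proof (rule sum.cong)
    fix p assume "p \<in> {2..n - 1}"
    then obtain p' where p: "p = Suc p'" by (cases p) auto
    show "?T (p - 1) = (\<Sum>(i, j)\<in>splittings k p. (\<Prod>a = 1..p. of_nat (k a choose i a)) *\<^sub>Q
          (\<Sum>(u, v)\<in>uv_choices i j (p - 1).
            (concat (map u [1..<p]) @ dy (i p)) \<otimes>\<^sub>s\<^sub>y\<^sub>m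
            (concat (map v [1..<p]) @ dpow (j p) @ dys k (p + 1) n)))"
      \<comment> \<open>The earlier blocks expand into splittings and choices; the splitting of
        block p then moves out to join theirs.\<close>
      unfolding p diff_Suc_1 split_sum_dys_choices
      using sum_splittings_uv_choices_snoc[where k = k and p = p' and
          H = "\<lambda>a b x y. (a @ dy x) \<otimes>\<^sub>s\<^sub>y\<^sub>m (b @ dpow y @ dys k (Suc (Suc p')) n)"]
      by simp
  qed simp
  finally show ?thesis
    by (simp add: dys_empty numeral_2_eq_2)
qed

end
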